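(* Let $u_0\in\mathcal H^1(\mathbb T^2)$, for $\varepsilon>0$ let $u_\varepsilon$ be the mild solution of $$\partial_t u_\varepsilon=-\Delta^2u_\varepsilon-\nabla\cdot\frac{\nabla u_\varepsilon}{1+|\nabla u_\varepsilon|^2}+\partial_tW_\varepsilon,\qquad u_\varepsilon(0)=u_0,$$ and set $v_\varepsilon(t)=u_\varepsilon(t)-Z_\varepsilon(t)-e^{tA}u_0$. For all $T>0$ there is a constant $C=C_{L,T}>0$ such that $$|\nabla v_\varepsilon(\omega,t,x)|\le C$$ for almost every $\omega\in\Omega$, every $t\in[0,T]$, $x\in\mathbb T^2$, and $\varepsilon>0$.
   Context: Fix $L>0$ and let $\mathbb{T}^2=[0,L]^2$ with periodic boundary conditions. All functions have zero spatial mean. Let $\mathcal{Z}=\mathbb{Z}^2\setminus\{0\}$ and $e_k(x)=\omega_{k_1}(x_1)\omega_{k_2}(x_2)$ for $k=(k_1,k_2)\in\mathbb Z^2$, where $\omega_j(z)=\sqrt{2/L}\,\sin(2\pi jz/L)$ for $j>0$, $\omega_0(z)=1/\sqrt L$, and $\omega_j(z)=\sqrt{2/L}\,\cos(2\pi jz/L)$ for $j<0$; this is an orthonormal basis of $L^2([0,L]^2)$. Let $\mu_k=(2\pi|k|/L)^2$, so $-\Delta e_k=\mu_ke_k$. For $\alpha\in\mathbb R$, $\mathcal{H}^\alpha=\mathcal H^\alpha(\mathbb T^2)$ is the space of (formal) series $u=\sum_{k\in\mathcal Z}u_ke_k$ with $\|u\|_{\mathcal H^\alpha}^2=\sum_{k\in\mathcal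 Z}\mu_k^\alpha u_k^2<\infty$. Let $A=-\Delta^2$ and $e^{tA}\sum_{k\in\mathcal Z}u_ke_k=\sum_{k\in\mathcal Z}e^{-t\mu_k^2}u_ke_k$. Noise: $(\beta_k)_{k\in\mathcal Z}$ are i.i.d. real-valued Wiener processes on a probability space $(\Omega,\mathbb P)$. The regularization coefficients $(\alpha_k^{(\varepsilon)})_{k\in\mathcal Z}$, $\varepsilon>0$, are real and satisfy: (i) $\sup_{\varepsilon>0}\sup_{k\in\mathcal Z}|\alpha_k^{(\varepsilon)}|<\infty$; (ii) for every $\varepsilon>0$ there are $\delta(\varepsilon)>0$, $C_\varepsilon>0$ with $|\alpha_k^{(\varepsilon)}|\le C_\varepsilon|k|^{-\delta(\varepsilon)}$ for all $k\in\mathcal Z$; (iii) $\alpha_k^{(\varepsilon)}\to1$ as $\varepsilon\to0$ for each fixed $k$; (iv) for every $\varepsilon>0$ there is $a_\varepsilon:[0,\infty)\to\mathbb R$ with $\alpha_k^{(\varepsilon)}=a_\varepsilon(|k|)$ for all $k\in\mathcal Z$. Set $W_\varepsilon(t)=\sum_{k\in\mathcal Z}\alpha_k^{(\varepsilon)}\beta_k(t)e_k$ and $Z_\varepsilon(t,x)=\sum_{k\in\mathcal Z}\alpha_k^{(\varepsilon)}\int_0^te^{-(t-s)\mu_k^2}\,d\beta_k(s)\,e_k(x)$. Mild solution with $u_0\in\mathcal H^1$: a process $(u_\varepsilon(t))_{t\in[0,T]}$ with continuous paths in $\mathcal H^1$ such that for all $t\in[0,T]$, $u_\varepsilon(t)=e^{tA}u_0+\int_0^te^{(t-s)A}\mathfrak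 F(u_\varepsilon(s))\,ds+Z_\varepsilon(t)$, where $\mathfrak F(u)=-\nabla\cdot f(\nabla u)$ and $f(y)=\frac{y}{1+|y|^2}$ for $y\in\mathbb R^2$. Thus $v_\varepsilon$ is the mild solution of $\partial_tv_\varepsilon=-\Delta^2v_\varepsilon-\nabla\cdot f(\nabla v_\varepsilon+\nabla Z_\varepsilon+\nabla e^{tA}u_0)$, $v_\varepsilon(0)=0$. *)

theory Defs
  imports "HOL-Probability.Probability"
begin

text \<open>
  Points of the plane are pairs of reals (with the Euclidean norm and inner product), wave vectors
  are pairs of integers. The torus is represented by its fundamental domain; functions on it are
  the L-periodic functions on the plane.
\<close>

definition torus :: "real \<Rightarrow> (real \<times> real) set" where
  "torus L = {0..L} \<times> {0..L}"

definition modes :: "(int \<times> int) set" where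
  "modes = UNIV - {(0, 0)}"

definition wave_norm :: "int \<times> int \<Rightarrow> real" where
  "wave_norm k = norm (real_of_int (fst k), real_of_int (snd k))"

definition basis1 :: "real \<Rightarrow> int \<Rightarrow> real \<Rightarrow> real" where
  "basis1 L j z =
     (if j > 0 then sqrt (2 / L) * sin (2 * pi * of_int j * z / L)
      else if j = 0 then 1 / sqrt L
      else sqrt (2 / L) * cos (2 * pi * of_int j * z / L))"

definition basis :: "real \<Rightarrow> int \<times> int \<Rightarrow> real \<times> real \<Rightarrow> real" where
  "basis L k x = basis1 L (fst k) (fst x) * basis1 L (snd k) (snd x)"

definition mu :: "real \<Rightarrow> int \<times> int \<Rightarrow> real" where
  "mu L k = (2 * pi * wave_norm k / L)\<^sup>2"

text \<open>
  A formal series is represented by its coefficient family. Only the coefficients with index in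
  \<open>modes\<close> matter: the value at \<open>(0, 0)\<close> is ignored throughout, which is the zero-mean convention.
\<close>

type_synonym coeffs = "int \<times> int \<Rightarrow> real"

definition in_H :: "real \<Rightarrow> real \<Rightarrow> coeffs \<Rightarrow> bool" where
  "in_H L a u \<longleftrightarrow> (\<lambda>k. mu L k powr a * (u k)\<^sup>2) summable_on modes"

definition H_norm :: "real \<Rightarrow> real \<Rightarrow> coeffs \<Rightarrow> real" where
  "H_norm L a u = sqrt (\<Sum>\<^sub>\<infinity>k\<in>modes. mu L k powr a * (u k)\<^sup>2)"

definition semigroup_A :: "real \<Rightarrow> real \<Rightarrow> coeffs \<Rightarrow> coeffs" where
  "semigroup_A L t u k = exp (- t * (mu L k)\<^sup>2) * u k"

definition series_value :: "real \<Rightarrow> coeffs \<Rightarrow> real \<times> real \<Rightarrow> real" where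
  "series_value L u x = (\<Sum>\<^sub>\<infinity>k\<in>modes. u k * basis L k x)"

definition grad :: "(real \<times> real \<Rightarrow> real) \<Rightarrow> real \<times> real \<Rightarrow> real \<times> real" where
  "grad h x = (THE D. GDERIV h x :> D)"

text \<open>
  For \<open>u\<close> in \<open>H\<^sup>1\<close> the gradient is the sum in \<open>L\<^sup>2\<close> of the series of the \<open>u\<^sub>k \<nabla>e\<^sub>k\<close>; it exists and is
  unique up to Lebesgue-null sets, and it is only used under integrals over the torus.
\<close>

definition is_L2_grad :: "real \<Rightarrow> coeffs \<Rightarrow> (real \<times> real \<Rightarrow> real \<times> real) \<Rightarrow> bool" where
  "is_L2_grad L u g \<longleftrightarrow>
     g \<in> borel_measurable lborel \<and>
     ((\<lambda>K. \<integral>\<^sup>+x\<in>torus L. ennreal ((norm (g x - (\<Sum>k\<in>K. u k *\<^sub>R grad (basis L k) x)))\<^sup>2) \<partial>lborel)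
        \<longlongrightarrow> 0) (finite_subsets_at_top modes)"

definition L2_grad :: "real \<Rightarrow> coeffs \<Rightarrow> real \<times> real \<Rightarrow> real \<times> real" where
  "L2_grad L u = (SOME g. is_L2_grad L u g)"

definition flux :: "real \<times> real \<Rightarrow> real \<times> real" where
  "flux y = y /\<^sub>R (1 + (norm y)\<^sup>2)"

text \<open>
  The distribution \<open>-\<nabla>\<cdot>f(\<nabla>u)\<close> as a formal series: its coefficients are its pairings with the \<open>e\<^sub>k\<close>,
  and the minus sign is absorbed by moving the divergence onto \<open>e\<^sub>k\<close> (no boundary terms on the torus).
\<close>

definition nonlinearity :: "real \<Rightarrow> coeffs \<Rightarrow> coeffs" where
  "nonlinearity L u k =
     (LINT x:torus L|lborel. flux (L2_grad L u x) \<bullet> grad (basis L k) x)"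

definition wiener_process :: "'a measure \<Rightarrow> (real \<Rightarrow> 'a \<Rightarrow> real) \<Rightarrow> bool" where
  "wiener_process M B \<longleftrightarrow>
     prob_space M \<and>
     (\<forall>t\<ge>0. B t \<in> borel_measurable M) \<and>
     (AE w in M. B 0 w = 0) \<and>
     (\<forall>s t. 0 \<le> s \<and> s < t \<longrightarrow>
        distributed M lborel (\<lambda>w. B t w - B s w) (normal_density 0 (sqrt (t - s)))) \<and>
     (\<forall>(n::nat) p. 0 \<le> p 0 \<and> (\<forall>i<n. p i \<le> p (Suc i)) \<longrightarrow>
        prob_space.indep_vars M (\<lambda>_. borel) (\<lambda>i w. B (p (Suc i)) w - B (p i) w) {..<n}) \<and>
     (AE w in M. continuous_on {0..} (\<lambda>t. B t w))"

definition independent_wiener_family ::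
    "'a measure \<Rightarrow> 'i set \<Rightarrow> ('i \<Rightarrow> real \<Rightarrow> 'a \<Rightarrow> real) \<Rightarrow> bool" where
  "independent_wiener_family M I \<beta> \<longleftrightarrow>
     (\<forall>k\<in>I. wiener_process M (\<beta> k)) \<and>
     prob_space.indep_vars M (\<lambda>_. PiM {0::real..} (\<lambda>_. borel))
       (\<lambda>k w. restrict (\<lambda>t. \<beta> k t w) {0..}) I"

text \<open>
  The stochastic integral over \<open>[0, t]\<close> of a deterministic square-integrable function: the
  \<open>L\<^sup>2(\<Omega>)\<close>-limit of the integrals of step functions converging to it in \<open>L\<^sup>2(0, t)\<close>. It is determined
  up to almost sure equality.
\<close>

definition step_fun :: "nat \<Rightarrow> (nat \<Rightarrow> real) \<Rightarrow> (nat \<Rightarrow> real) \<Rightarrow> real \<Rightarrow> real" where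
  "step_fun n p c s = (\<Sum>i<n. c i * indicator {p i<..p (Suc i)} s)"

definition step_integral ::
    "(real \<Rightarrow> 'a \<Rightarrow> real) \<Rightarrow> nat \<Rightarrow> (nat \<Rightarrow> real) \<Rightarrow> (nat \<Rightarrow> real) \<Rightarrow> 'a \<Rightarrow> real" where
  "step_integral B n p c w = (\<Sum>i<n. c i * (B (p (Suc i)) w - B (p i) w))"

definition has_wiener_integral ::
    "'a measure \<Rightarrow> (real \<Rightarrow> 'a \<Rightarrow> real) \<Rightarrow> real \<Rightarrow> (real \<Rightarrow> real) \<Rightarrow> ('a \<Rightarrow> real) \<Rightarrow> bool" where
  "has_wiener_integral M B t g J \<longleftrightarrow>
     J \<in> borel_measurable M \<and>
     (\<exists>(n :: nat \<Rightarrow> nat) p c.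
        (\<forall>m. p m 0 = 0 \<and> p m (n m) = t \<and> (\<forall>i<n m. p m i \<le> p m (Suc i))) \<and>
        (\<lambda>m. \<integral>\<^sup>+s\<in>{0..t}. ennreal ((step_fun (n m) (p m) (c m) s - g s)\<^sup>2) \<partial>lborel)
          \<longlonglongrightarrow> 0 \<and>
        (\<lambda>m. \<integral>\<^sup>+w. ennreal ((step_integral B (n m) (p m) (c m) w - J w)\<^sup>2) \<partial>M)
          \<longlonglongrightarrow> 0)"

text \<open>
  \<open>z k t\<close> is a version of \<open>\<integral>\<^sub>0\<^sup>t exp (-(t - s) \<mu>\<^sub>k\<^sup>2) d\<beta>\<^sub>k(s)\<close>. These integrals do not involve the
  regularization parameter, so one version serves all of its values simultaneously.
\<close>

definition stochastic_convolution ::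
    "'a measure \<Rightarrow> real \<Rightarrow> (int \<times> int \<Rightarrow> real \<Rightarrow> 'a \<Rightarrow> real) \<Rightarrow>
     (int \<times> int \<Rightarrow> real \<Rightarrow> 'a \<Rightarrow> real) \<Rightarrow> bool" where
  "stochastic_convolution M L \<beta> z \<longleftrightarrow>
     (\<forall>k\<in>modes. \<forall>t\<ge>0.
        has_wiener_integral M (\<beta> k) t (\<lambda>s. exp (- (t - s) * (mu L k)\<^sup>2)) (z k t))"

definition regularization :: "(real \<Rightarrow> int \<times> int \<Rightarrow> real) \<Rightarrow> bool" where
  "regularization \<alpha> \<longleftrightarrow>
     (\<exists>C. \<forall>\<epsilon>>0. \<forall>k\<in>modes. \<bar>\<alpha> \<epsilon> k\<bar> \<le> C) \<and>
     (\<forall>\<epsilon>>0. \<exists>\<delta>>0. \<exists>C>0. \<forall>k\<in>modes. \<bar>\<alpha> \<epsilon> k\<bar> \<le> C * wave_norm k powr (- \<delta>)) \<and>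
     (\<forall>k\<in>modes. ((\<lambda>\<epsilon>. \<alpha> \<epsilon> k) \<longlongrightarrow> 1) (at_right 0)) \<and>
     (\<forall>\<epsilon>>0. \<exists>a :: real \<Rightarrow> real. \<forall>k\<in>modes. \<alpha> \<epsilon> k = a (wave_norm k))"

definition noise_Z ::
    "(real \<Rightarrow> int \<times> int \<Rightarrow> real) \<Rightarrow> (int \<times> int \<Rightarrow> real \<Rightarrow> 'a \<Rightarrow> real) \<Rightarrow>
     real \<Rightarrow> real \<Rightarrow> 'a \<Rightarrow> coeffs" where
  "noise_Z \<alpha> z \<epsilon> t w k = \<alpha> \<epsilon> k * z k t w"

text \<open>
  A single path \<open>u\<close>, driven by the noise path \<open>Z\<close>. The integral in the mild equation is taken
  coefficientwise; for \<open>u\<close> continuous in \<open>H\<^sup>1\<close> its integrand is Bochner integrable in \<open>H\<^sup>1\<close>, and the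
  coefficients of the Bochner integral are the integrals of the coefficients.
\<close>

definition mild_path ::
    "real \<Rightarrow> real \<Rightarrow> coeffs \<Rightarrow> (real \<Rightarrow> coeffs) \<Rightarrow> (real \<Rightarrow> coeffs) \<Rightarrow> bool" where
  "mild_path L T u0 Z u \<longleftrightarrow>
     (\<forall>t\<in>{0..T}. in_H L 1 (u t)) \<and>
     (\<forall>t\<in>{0..T}. ((\<lambda>s. H_norm L 1 (\<lambda>k. u s k - u t k)) \<longlongrightarrow> 0) (at t within {0..T})) \<and>
     (\<forall>t\<in>{0..T}. \<forall>k\<in>modes.
        u t k = semigroup_A L t u0 k
              + (LINT s:{0..t}|lborel. semigroup_A L (t - s) (nonlinearity L (u s)) k)
              + Z t k)"

definition mild_solution ::
    "'a measure \<Rightarrow> real \<Rightarrow> real \<Rightarrow> coeffs \<Rightarrow> (real \<Rightarrow> 'a \<Rightarrow> coeffs) \<Rightarrow>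
     (real \<Rightarrow> 'a \<Rightarrow> coeffs) \<Rightarrow> bool" where
  "mild_solution M L T u0 Z u \<longleftrightarrow>
     (\<forall>t\<in>{0..T}. \<forall>k\<in>modes. (\<lambda>w. u t w k) \<in> borel_measurable M) \<and>
     (AE w in M. mild_path L T u0 (\<lambda>t. Z t w) (\<lambda>t. u t w))"

definition remainder_v ::
    "real \<Rightarrow> coeffs \<Rightarrow> (real \<Rightarrow> 'a \<Rightarrow> coeffs) \<Rightarrow> (real \<Rightarrow> 'a \<Rightarrow> coeffs) \<Rightarrow>
     real \<Rightarrow> 'a \<Rightarrow> coeffs" where
  "remainder_v L u0 Z u t w k = u t w k - Z t w k - semigroup_A L t u0 k"

text \<open>
  The gradient is the classical one, so its existence (and that of the sum of the series) is
  part of the claim.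
\<close>

definition gradient_bounded_at :: "real \<Rightarrow> real \<Rightarrow> coeffs \<Rightarrow> real \<times> real \<Rightarrow> bool" where
  "gradient_bounded_at L C v x \<longleftrightarrow>
     (\<lambda>k. v k * basis L k x) summable_on modes \<and>
     (\<exists>D. GDERIV (series_value L v) x :> D \<and> norm D \<le> C)"

end

theory Submission
  imports Defs
begin

text \<open>
  The bound is pathwise and comes from the boundedness of the flux alone. For a mild path the
  coefficients of the remainder are \<open>v\<^sub>k(t) = \<integral>\<^sub>0\<^sup>t exp (-(t - s) \<mu>\<^sub>k\<^sup>2) N\<^sub>k(s) ds\<close>, where \<open>N\<^sub>k(s)\<close> is the pairing
  of \<open>F(s) = f(\<nabla>u(s))\<close> with \<open>\<nabla>e\<^sub>k\<close>, and \<open>|F| \<le> 1/2\<close> whatever \<open>u\<close> is; so the noise, the regularization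
  and the initial datum cannot enter the constant.

  The fields \<open>\<nabla>e\<^sub>k / \<surd>\<mu>\<^sub>k\<close> are orthonormal in \<open>L\<^sup>2\<close> of the torus, hence Bessel's inequality gives
  \<open>\<Sum>\<^sub>k N\<^sub>k(s)\<^sup>2 / \<mu>\<^sub>k \<le> L\<^sup>2 / 4\<close> (\<open>bessel_basis_gradients\<close>). Since \<open>|\<nabla>e\<^sub>k| \<le> (2 / L) \<surd>\<mu>\<^sub>k\<close>, it is enough to
  bound \<open>\<Sum>\<^sub>k \<surd>\<mu>\<^sub>k |v\<^sub>k(t)|\<close>. With \<open>\<tau> = t - s\<close> and \<open>exp (-x) \<le> x\<^sup>-\<^sup>a\<close> for \<open>0 \<le> a \<le> 1\<close>, the integrand is at most
  \<open>\<tau>\<^sup>-\<^sup>a \<Sum>\<^sub>k \<mu>\<^sub>k powr (1 - 2 a) (|N\<^sub>k| / \<surd>\<mu>\<^sub>k)\<close>, and Cauchy--Schwarz leaves the lattice sum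
  \<open>\<Sum>\<^sub>k \<mu>\<^sub>k powr (2 - 4 a)\<close>. In dimension two this sum converges exactly when \<open>a > 3/4\<close>, whereas \<open>\<tau>\<^sup>-\<^sup>a\<close> is
  integrable at \<open>0\<close> exactly when \<open>a < 1\<close>. The choice \<open>a = 7/8\<close> satisfies both
  (\<open>heat_smoothing_bessel\<close>, \<open>duhamel_gradient_sum_le\<close>). Bounding each \<open>N\<^sub>k\<close> separately
  by a multiple of \<open>\<surd>\<mu>\<^sub>k\<close> would lead to the divergent \<open>\<integral> \<tau>\<^sup>-\<^sup>1 d\<tau>\<close>, which is why orthogonality is used.

  The resulting absolute convergence of \<open>\<Sum>\<^sub>k v\<^sub>k \<nabla>e\<^sub>k\<close>, uniform in \<open>x\<close>, also justifies termwise
  differentiation (\<open>gradient_bounded_series\<close>), so that the gradient exists in the classical sense.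
\<close>

section \<open>The trigonometric basis and its gradients\<close>

text \<open>
  Writing every \<open>\<omega>\<^sub>j\<close> as an amplitude times a shifted cosine treats the sine, cosine and constant
  cases of the orthonormality computation by a single product formula.
\<close>

definition basis1_phase :: "int \<Rightarrow> real" where
  "basis1_phase j = (if j > 0 then pi / 2 else 0)"

definition basis1_amp :: "real \<Rightarrow> int \<Rightarrow> real" where
  "basis1_amp L j = (if j = 0 then 1 / sqrt L else sqrt (2 / L))"

lemma basis1_eq_phase:
  "basis1 L j z = basis1_amp L j * cos (2 * pi * of_int j / L * z - basis1_phase j)"
  by (auto simp: basis1_def basis1_amp_def basis1_phase_def cos_diff)

lemma abs_basis1_le:
  assumes "L > 0"
  shows "\<bar>basis1 L j z\<bar> \<le> sqrt (2 / L)"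
proof -
  have "\<bar>basis1 L j z\<bar> \<le> \<bar>basis1_amp L j\<bar>"
    unfolding basis1_eq_phase abs_mult by (rule mult_left_le) auto
  also have "\<dots> \<le> sqrt (2 / L)"
    using assms by (auto simp: basis1_amp_def real_sqrt_divide divide_right_mono)
  finally show ?thesis .
qed

text \<open>
  Differentiation exchanges sine and cosine of the same frequency, which in this indexing is the
  sign change of \<open>j\<close>. Thus derivatives of basis functions are multiples of basis functions.
\<close>

lemma has_real_derivative_basis1:
  assumes "L > 0"
  shows "(basis1 L j has_real_derivative 2 * pi * of_int j / L * basis1 L (- j) z) (at z)"
proof -
  consider "j > 0" | "j = 0" | "j < 0" by linarith
  then show ?thesis
  proof cases
    case 1
    then have "basis1 L j = (\<lambda>z. sqrt (2 / L) * sin (2 * pi * of_int j * z / L))"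
      by (simp add: basis1_def fun_eq_iff)
    then show ?thesis using 1 assms
      by (auto simp: basis1_def intro!: derivative_eq_intros)
  next
    case 2
    then have "basis1 L j = (\<lambda>z. 1 / sqrt L)"
      by (simp add: basis1_def fun_eq_iff)
    then show ?thesis using 2 by simp
  next
    case 3
    then have "basis1 L j = (\<lambda>z. sqrt (2 / L) * cos (2 * pi * of_int j * z / L))"
      by (simp add: basis1_def fun_eq_iff)
    then show ?thesis using 3 assms
      by (auto simp: basis1_def intro!: derivative_eq_intros)
  qed
qed

lemma continuous_on_basis1 [continuous_intros]:
  fixes g :: "'a::t2_space \<Rightarrow> real"
  assumes "continuous_on S g"
  shows "continuous_on S (\<lambda>x. basis1 L j (g x))"
  unfolding basis1_eq_phase
  by (intro continuous_on_mult continuous_on_cos continuous_on_diff continuous_on_const assms)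

lemma has_integral_cos_period:
  assumes "L > 0"
  shows "((\<lambda>z. cos (2 * pi * of_int m / L * z - p)) has_integral (if m = 0 then L * cos p else 0)) {0..L}"
proof (cases "m = 0")
  case True
  then show ?thesis using has_integral_const_real[of "cos p" 0 L] assms by simp
next
  case False
  define a where "a = 2 * pi * of_int m / L"
  have "a \<noteq> 0" using False assms by (simp add: a_def)
  then have "((\<lambda>z. cos (a * z - p)) has_integral (sin (a * L - p) / a - sin (a * 0 - p) / a)) {0..L}"
    using assms
    by (intro fundamental_theorem_of_calculus)
       (auto intro!: derivative_eq_intros simp flip: has_real_derivative_iff_has_vector_derivative)
  moreover have "sin (a * L - p) = sin (- p)"
    using assms sin_int_2pin[of m] cos_int_2pin[of m]
    by (simp add: a_def sin_diff)
  ultimately show ?thesis using False by (simp add: a_def)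
qed

text \<open>
  The product of two shifted cosines is half the sum of the cosines with the difference and the sum
  of the frequencies, and only frequency zero survives integration over a period. For \<open>j = - i \<noteq> 0\<close>
  the surviving term vanishes too, because the phases then add up to \<open>\<pi> / 2\<close>.
\<close>

lemma basis1_orthonormal:
  assumes "L > 0"
  shows "(LINT z:{0..L}|lborel. basis1 L i z * basis1 L j z) = (if i = j then 1 else 0)"
proof -
  let ?c = "basis1_amp L i * basis1_amp L j / 2"
  let ?f = "\<lambda>m p z. cos (2 * pi * of_int m / L * z - p)"
  let ?p = "basis1_phase"
  have eq: "basis1 L i z * basis1 L j z = ?c * (?f (i - j) (?p i - ?p j) z + ?f (i + j) (?p i + ?p j) z)" for z
    using cos_times_cos[of "2 * pi * of_int i / L * z - ?p i" "2 * pi * of_int j / L * z - ?p j"]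
    by (simp add: basis1_eq_phase algebra_simps diff_divide_distrib add_divide_distrib)
  have hi: "((\<lambda>z. basis1 L i z * basis1 L j z) has_integral
      ?c * ((if i - j = 0 then L * cos (?p i - ?p j) else 0) + (if i + j = 0 then L * cos (?p i + ?p j) else 0))) {0..L}"
    unfolding eq by (intro has_integral_mult_right has_integral_add has_integral_cos_period assms)
  have "set_integrable lborel {0..L} (\<lambda>z. basis1 L i z * basis1 L j z)"
    by (intro borel_integrable_atLeastAtMost' continuous_intros)
  from set_borel_integral_eq_integral(2)[OF this] hi
  have "(LINT z:{0..L}|lborel. basis1 L i z * basis1 L j z) =
     ?c * ((if i - j = 0 then L * cos (?p i - ?p j) else 0) + (if i + j = 0 then L * cos (?p i + ?p j) else 0))"
    by (simp add: integral_unique)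
  also have "\<dots> = (if i = j then 1 else 0)"
  proof -
    have "i + j = 0 \<longleftrightarrow> j = - i" by linarith
    then show ?thesis
      using assms by (auto simp: basis1_amp_def basis1_phase_def)
  qed
  finally show ?thesis .
qed

lemma abs_basis_le:
  assumes "L > 0"
  shows "\<bar>basis L k x\<bar> \<le> 2 / L"
proof -
  have "\<bar>basis L k x\<bar> \<le> sqrt (2 / L) * sqrt (2 / L)"
    unfolding basis_def abs_mult by (intro mult_mono abs_basis1_le assms) (use assms in auto)
  then show ?thesis using assms by simp
qed

lemma continuous_on_basis [continuous_intros]: "continuous_on S (basis L k)"
  unfolding basis_def[abs_def] by (intro continuous_intros)

lemma compact_torus: "compact (torus L)"
  unfolding torus_def by (intro compact_Times) auto

lemma set_integrable_torus_continuous: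
  fixes f :: "real \<times> real \<Rightarrow> real"
  assumes "continuous_on (torus L) f"
  shows "set_integrable lborel (torus L) f"
  unfolding set_integrable_def by (intro borel_integrable_compact compact_torus assms)

lemma basis_orthonormal:
  assumes "L > 0"
  shows "(LINT x:torus L|lborel. basis L j x * basis L k x) = (if j = k then 1 else 0)"
proof -
  let ?g = "\<lambda>i j z. indicator {0..L} z *\<^sub>R (basis1 L i z * basis1 L j z)"
  have eq: "indicator (torus L) x *\<^sub>R (basis L j x * basis L k x)
     = ?g (fst j) (fst k) (fst x) * ?g (snd j) (snd k) (snd x)" for x
    by (cases x) (simp add: torus_def basis_def indicator_times algebra_simps)
  have "set_integrable lborel (torus L) (\<lambda>x. basis L j x * basis L k x)"
    by (intro set_integrable_torus_continuous continuous_intros)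
  then have "integrable (lborel \<Otimes>\<^sub>M lborel) (\<lambda>x. ?g (fst j) (fst k) (fst x) * ?g (snd j) (snd k) (snd x))"
    unfolding set_integrable_def eq lborel_prod .
  from lborel_pair.integral_fst'[OF this]
  have "(LINT x:torus L|lborel. basis L j x * basis L k x) =
    (LINT z|lborel. ?g (fst j) (fst k) z) * (LINT z|lborel. ?g (snd j) (snd k) z)"
    unfolding set_lebesgue_integral_def eq lborel_prod
    by simp
  also have "\<dots> = (if j = k then 1 else 0)"
    using basis1_orthonormal[OF assms, of "fst j" "fst k"] basis1_orthonormal[OF assms, of "snd j" "snd k"]
    unfolding set_lebesgue_integral_def by (simp add: prod_eq_iff)
  finally show ?thesis .
qed

definition basis_grad :: "real \<Rightarrow> int \<times> int \<Rightarrow> real \<times> real \<Rightarrow> real \<times> real" where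
  "basis_grad L k x = (2 * pi / L) *\<^sub>R
     (of_int (fst k) * basis L (- fst k, snd k) x, of_int (snd k) * basis L (fst k, - snd k) x)"

lemma GDERIV_basis:
  assumes "L > 0"
  shows "GDERIV (basis L k) x :> basis_grad L k x"
proof -
  have D: "(basis1 L j has_derivative (\<lambda>h. 2 * pi * of_int j / L * basis1 L (- j) z * h)) (at z within S)" for j z S
    using has_derivative_at_withinI[OF has_real_derivative_basis1[OF assms, unfolded has_field_derivative_def]] .
  have "((\<lambda>x. basis1 L (fst k) (fst x) * basis1 L (snd k) (snd x)) has_derivative (\<lambda>h. h \<bullet> basis_grad L k x)) (at x)"
    apply (rule derivative_eq_intros has_derivative_compose[OF _ D] | simp)+
    by (auto simp: basis_grad_def basis_def fun_eq_iff inner_prod_def algebra_simps)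
  then show ?thesis
    unfolding gderiv_def basis_def[abs_def] .
qed

lemma grad_eqI:
  assumes "GDERIV h x :> D"
  shows "grad h x = D"
  unfolding grad_def
proof (rule the_equality)
  fix D' assume "GDERIV h x :> D'"
  with assms have "(\<lambda>h. h \<bullet> D) = (\<lambda>h. h \<bullet> D')"
    unfolding gderiv_def by (rule has_derivative_unique)
  then show "D' = D" by (metis vector_eq_ldot)
qed (fact assms)

lemma grad_basis:
  assumes "L > 0"
  shows "grad (basis L k) = basis_grad L k"
  by (rule ext) (rule grad_eqI[OF GDERIV_basis[OF assms]])

lemma mu_eq: "mu L k = (2 * pi / L)\<^sup>2 * ((of_int (fst k))\<^sup>2 + (of_int (snd k))\<^sup>2)"
  by (simp add: mu_def wave_norm_def norm_Pair power_mult_distrib power_divide)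

lemma wave_norm_ge_1:
  assumes "k \<in> modes" shows "wave_norm k \<ge> 1"
proof -
  have "(fst k)\<^sup>2 + (snd k)\<^sup>2 > 0"
    using assms by (auto simp: modes_def prod_eq_iff sum_power2_gt_zero_iff)
  then have "(1::int) \<le> (fst k)\<^sup>2 + (snd k)\<^sup>2" by linarith
  then have "real_of_int 1 \<le> real_of_int ((fst k)\<^sup>2 + (snd k)\<^sup>2)"
    by (simp only: of_int_le_iff)
  then show ?thesis by (simp add: wave_norm_def norm_Pair)
qed

lemma mu_nonneg: "mu L k \<ge> 0"
  by (simp add: mu_def)

lemma mu_pos:
  assumes "L > 0" "k \<in> modes" shows "mu L k > 0"
  using wave_norm_ge_1[OF assms(2)] assms(1) by (simp add: mu_def)

lemma norm_basis_grad_le: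
  assumes "L > 0"
  shows "norm (basis_grad L k x) \<le> 2 / L * sqrt (mu L k)"
proof (rule power2_le_imp_le)
  have b: "(basis L j x)\<^sup>2 \<le> (2 / L)\<^sup>2" for j
    using abs_basis_le[OF assms, of j x] assms
    by (subst abs_le_square_iff[symmetric]) simp
  have "(norm (basis_grad L k x))\<^sup>2 = (2 * pi / L)\<^sup>2 *
     ((of_int (fst k))\<^sup>2 * (basis L (- fst k, snd k) x)\<^sup>2 + (of_int (snd k))\<^sup>2 * (basis L (fst k, - snd k) x)\<^sup>2)"
    by (simp add: basis_grad_def norm_Pair power_mult_distrib power_divide algebra_simps)
  also have "\<dots> \<le> (2 * pi / L)\<^sup>2 * ((of_int (fst k))\<^sup>2 * (2 / L)\<^sup>2 + (of_int (snd k))\<^sup>2 * (2 / L)\<^sup>2)"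
    by (intro mult_left_mono add_mono b) auto
  also have "\<dots> = (2 / L * sqrt (mu L k))\<^sup>2"
  proof -
    have "(sqrt (mu L k))\<^sup>2 = mu L k" by (rule real_sqrt_pow2) (simp add: mu_def)
    then have "(2 / L * sqrt (mu L k))\<^sup>2 = (2 / L)\<^sup>2 * mu L k"
      by (simp only: power_mult_distrib)
    then show ?thesis by (simp add: mu_eq algebra_simps)
  qed
  finally show "(norm (basis_grad L k x))\<^sup>2 \<le> (2 / L * sqrt (mu L k))\<^sup>2" .
qed (use assms in \<open>auto simp: mu_def\<close>)

text \<open>
  Both components of \<open>\<nabla>e\<^sub>j\<close> and \<open>\<nabla>e\<^sub>k\<close> are multiples of basis functions, with the indices reflected in
  the same coordinate, so orthogonality is inherited from the basis, and the squared norm is the sum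
  of the squared frequencies.
\<close>

lemma basis_grad_orthogonal:
  assumes "L > 0"
  shows "set_integrable lborel (torus L) (\<lambda>x. basis_grad L j x \<bullet> basis_grad L k x)" (is ?I)
    and "(LINT x:torus L|lborel. basis_grad L j x \<bullet> basis_grad L k x) = (if j = k then mu L k else 0)" (is ?E)
proof -
  have c: "continuous_on S (basis_grad L k)" for S k
    unfolding basis_grad_def[abs_def] by (intro continuous_intros)
  show ?I
    by (intro set_integrable_torus_continuous continuous_intros c)
  let ?a = "(2 * pi / L)\<^sup>2"
  have eq: "basis_grad L j x \<bullet> basis_grad L k x =
    ?a * of_int (fst j) * of_int (fst k) * (basis L (- fst j, snd j) x * basis L (- fst k, snd k) x)
    + ?a * of_int (snd j) * of_int (snd k) * (basis L (fst j, - snd j) x * basis L (fst k, - snd k) x)" for x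
    by (simp add: basis_grad_def inner_prod_def power2_eq_square algebra_simps)
  have i: "set_integrable lborel (torus L) (\<lambda>x. c * (basis L j x * basis L k x))" for j k c
    by (intro set_integrable_torus_continuous continuous_intros)
  show ?E
    unfolding eq
    by (subst set_integral_add) (auto simp: i basis_orthonormal[OF assms] mu_eq prod_eq_iff power2_eq_square algebra_simps)
qed

section \<open>Bessel inequality for the gradients of the basis\<close>

lemma set_integral_finite_sum:
  fixes f :: "'i \<Rightarrow> 'a \<Rightarrow> real"
  assumes "finite I" "\<And>i. i \<in> I \<Longrightarrow> set_integrable M A (f i)"
  shows "set_integrable M A (\<lambda>x. \<Sum>i\<in>I. f i x)"
    and "(LINT x:A|M. \<Sum>i\<in>I. f i x) = (\<Sum>i\<in>I. LINT x:A|M. f i x)"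
  using assms unfolding set_integrable_def set_lebesgue_integral_def scaleR_sum_right
  by (simp_all only: Bochner_Integration.integrable_sum Bochner_Integration.integral_sum)

lemma set_integral_const_torus:
  assumes "L > 0"
  shows "set_integrable lborel (torus L) (\<lambda>x. c::real)" "(LINT x:torus L|lborel. c::real) = L\<^sup>2 * c"
proof -
  show "set_integrable lborel (torus L) (\<lambda>x. c::real)"
    by (intro set_integrable_torus_continuous continuous_intros)
  have "torus L = cbox (0, 0) (L, L)" by (simp add: torus_def cbox_Pair_eq)
  then have "measure lborel (torus L) = L\<^sup>2"
    using assms by (simp add: content_Pair power2_eq_square)
  then show "(LINT x:torus L|lborel. c::real) = L\<^sup>2 * c"
    unfolding set_lebesgue_integral_def by simp
qed

text \<open>
  Let \<open>P\<close> be the projection of \<open>F\<close> onto the span of the \<open>\<nabla>e\<^sub>k\<close>, \<open>k \<in> K\<close>. Then \<open>\<integral> F \<bullet> P = \<integral> P \<bullet> P\<close> is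
  the sum \<open>S\<close> in question, while \<open>F \<bullet> P \<le> (B\<^sup>2 + |P|\<^sup>2) / 2\<close> pointwise, so \<open>S \<le> (B\<^sup>2 L\<^sup>2 + S) / 2\<close>.
  A term whose integrand fails to be integrable has the integral \<open>0\<close> by convention; the projection is
  therefore formed with the integrable terms \<open>J\<close> only.
\<close>

lemma bessel_basis_gradients:
  assumes L: "L > 0" and K: "finite K" "K \<subseteq> modes"
    and F: "\<And>x. norm (F x) \<le> B"
  shows "(\<Sum>k\<in>K. (LINT x:torus L|lborel. F x \<bullet> grad (basis L k) x)\<^sup>2 / mu L k) \<le> (B * L)\<^sup>2"
proof -
  define N where "N k = (LINT x:torus L|lborel. F x \<bullet> basis_grad L k x)" for k
  define J where "J = {k \<in> K. set_integrable lborel (torus L) (\<lambda>x. F x \<bullet> basis_grad L k x)}"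
  define c where "c k = N k / mu L k" for k
  define P where "P x = (\<Sum>k\<in>J. c k *\<^sub>R basis_grad L k x)" for x
  define S where "S = (\<Sum>k\<in>J. (N k)\<^sup>2 / mu L k)"
  have J: "finite J" "J \<subseteq> K" using K by (auto simp: J_def)
  have zero: "N k = 0" if "k \<in> K - J" for k
    using that by (auto simp: J_def N_def set_integrable_def set_lebesgue_integral_def not_integrable_integral_eq)
  have S: "(\<Sum>k\<in>K. (N k)\<^sup>2 / mu L k) = S"
    unfolding S_def using zero by (intro sum.mono_neutral_right K(1) J) auto
  have FP: "F x \<bullet> P x = (\<Sum>k\<in>J. c k * (F x \<bullet> basis_grad L k x))" for x
    by (simp add: P_def inner_sum_right)
  have iFP: "set_integrable lborel (torus L) (\<lambda>x. F x \<bullet> P x)"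
    unfolding FP by (intro set_integral_finite_sum J) (auto simp: J_def)
  have eFP: "(LINT x:torus L|lborel. F x \<bullet> P x) = S"
    unfolding FP
    by (subst set_integral_finite_sum(2)) (auto simp: J_def K(1) S_def c_def N_def power2_eq_square)
  have PP: "P x \<bullet> P x = (\<Sum>j\<in>J. \<Sum>k\<in>J. c j * c k * (basis_grad L j x \<bullet> basis_grad L k x))" for x
  proof -
    have "P x \<bullet> P x = (\<Sum>j\<in>J. c j * (basis_grad L j x \<bullet> P x))"
      by (subst (1) P_def) (simp add: inner_sum_left)
    then show ?thesis
      by (simp add: P_def inner_sum_right sum_distrib_left mult.assoc)
  qed
  have iPP: "set_integrable lborel (torus L) (\<lambda>x. P x \<bullet> P x)"
    unfolding PP by (intro set_integral_finite_sum J set_integrable_mult_right impI basis_grad_orthogonal L)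
  have "(LINT x:torus L|lborel. P x \<bullet> P x) = (\<Sum>j\<in>J. \<Sum>k\<in>J. c j * c k * (if j = k then mu L k else 0))"
    unfolding PP
    by (subst set_integral_finite_sum(2) | intro J(1) set_integral_finite_sum(1) set_integrable_mult_right impI basis_grad_orthogonal(1) L sum.cong refl)+
       (simp add: basis_grad_orthogonal L)
  also have "\<dots> = (\<Sum>k\<in>J. (c k)\<^sup>2 * mu L k)"
    using J(1) by (simp add: if_distrib[of "\<lambda>y. _ * y"] power2_eq_square cong: if_cong)
  also have "\<dots> = S"
    unfolding S_def
  proof (rule sum.cong[OF refl])
    fix k assume "k \<in> J"
    then have "mu L k > 0" using mu_pos[OF L, of k] J K by auto
    then show "(c k)\<^sup>2 * mu L k = (N k)\<^sup>2 / mu L k"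
      by (simp add: c_def power2_eq_square)
  qed
  finally have ePP: "(LINT x:torus L|lborel. P x \<bullet> P x) = S" .
  have le: "F x \<bullet> P x \<le> B\<^sup>2 / 2 + 1 / 2 * (P x \<bullet> P x)" for x
  proof -
    have "F x \<bullet> F x \<le> B\<^sup>2"
      using F[of x] by (simp add: dot_square_norm abs_le_square_iff[symmetric])
    moreover have "0 \<le> (F x - P x) \<bullet> (F x - P x)" by simp
    ultimately show ?thesis
      by (simp add: inner_diff_left inner_diff_right inner_commute)
  qed
  have "S \<le> (LINT x:torus L|lborel. B\<^sup>2 / 2 + 1 / 2 * (P x \<bullet> P x))"
    unfolding eFP[symmetric]
    by (intro set_integral_mono iFP set_integral_add(1) set_integral_const_torus(1) set_integrable_mult_right iPP L le)
  also have "\<dots> = L\<^sup>2 * (B\<^sup>2 / 2) + 1 / 2 * S"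
    by (subst set_integral_add(2))
       (use set_integral_const_torus[OF L] set_integrable_mult_right[of "1/2", OF iPP] in \<open>auto simp: iPP ePP\<close>)
  finally have "S \<le> (B * L)\<^sup>2"
    by (simp add: power_mult_distrib algebra_simps)
  with S show ?thesis
    unfolding grad_basis[OF L] N_def by simp
qed

section \<open>Smoothing by the biharmonic heat semigroup\<close>

lemma norm_flux_le: "norm (flux y) \<le> 1 / 2"
proof -
  have "2 * norm y \<le> 1 + (norm y)\<^sup>2"
    using zero_le_power2[of "norm y - 1"] by (simp add: power2_diff)
  then show ?thesis
    by (simp add: flux_def divide_simps add_pos_nonneg)
qed

lemma summable_on_int_powr:
  "(\<lambda>j::int. (1 + (of_int j)\<^sup>2) powr (- 3 / 4) :: real) summable_on UNIV"
proof -
  let ?g = "\<lambda>j::int. (1 + (of_int j)\<^sup>2) powr (- 3 / 4) :: real"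
  have "summable (\<lambda>n. of_nat n powr (- 3 / 2) :: real)"
    by (subst summable_real_powr_iff) simp
  moreover have "norm (?g (int n)) \<le> of_nat n powr (- 3 / 2)" if "n \<ge> 1" for n
  proof -
    have "?g (int n) \<le> ((of_nat n)\<^sup>2) powr (- 3 / 4)"
      using that by (intro powr_mono2') auto
    also have "\<dots> = of_nat n powr (- 3 / 2)"
      using that by (simp add: powr_powr flip: powr_numeral)
    finally show ?thesis by simp
  qed
  ultimately have "summable (\<lambda>n. ?g (int n))"
    by (rule summable_comparison_test'[where N = 1])
  then have nat: "(\<lambda>n. ?g (int n)) summable_on UNIV"
    by (simp add: summable_on_UNIV_nonneg_real_iff)
  have "?g summable_on range int"
    using nat by (subst summable_on_reindex) (auto simp: o_def)
  moreover have "?g summable_on range (\<lambda>n. - int n)"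
    using nat by (subst summable_on_reindex) (auto simp: o_def inj_on_def)
  ultimately have "?g summable_on (range int \<union> range (\<lambda>n. - int n))"
    by (rule summable_on_union)
  moreover have "range int \<union> range (\<lambda>n. - int n) = UNIV"
    by (auto simp: image_iff) (metis int_cases2)
  ultimately show ?thesis by simp
qed

text \<open>
  Up to a factor, this is the sum of \<open>|k|\<^sup>-\<^sup>3\<close> over the punctured lattice. On it \<open>(1 + k\<^sub>1\<^sup>2) (1 + k\<^sub>2\<^sup>2) \<le> (2 |k|\<^sup>2)\<^sup>2\<close>, which reduces
  the double sum to a product of two convergent one-dimensional sums.
\<close>

lemma summable_on_mu_powr:
  assumes "L > 0"
  shows "(\<lambda>k. mu L k powr (- 3 / 2)) summable_on modes"
proof -
  let ?g = "\<lambda>j::int. (1 + (of_int j)\<^sup>2) powr (- 3 / 4) :: real"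
  let ?a = "((2 * pi / L)\<^sup>2 / 2) powr (- 3 / 2)"
  have "(\<lambda>(i, j). ?g i * ?g j) summable_on UNIV \<times> UNIV"
    by (rule summable_on_SigmaI[where g = "\<lambda>i. ?g i * (\<Sum>\<^sub>\<infinity>j. ?g j)"])
       (auto intro!: has_sum_cmult_right summable_on_cmult_left has_sum_infsum summable_on_int_powr[simplified])
  then have "(\<lambda>k. ?a * (?g (fst k) * ?g (snd k))) summable_on UNIV"
    by (intro summable_on_cmult_right) (simp add: case_prod_beta')
  then have "(\<lambda>k. ?a * (?g (fst k) * ?g (snd k))) summable_on modes"
    by (rule summable_on_subset_banach) simp
  then show ?thesis
  proof (rule summable_on_comparison_test)
    fix k assume k: "k \<in> modes"
    let ?x = "1 + (of_int (fst k))\<^sup>2 :: real" and ?y = "1 + (of_int (snd k))\<^sup>2 :: real"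
    let ?r = "(of_int (fst k))\<^sup>2 + (of_int (snd k))\<^sup>2 :: real"
    have r: "?r \<ge> 1"
      using wave_norm_ge_1[OF k] by (simp add: wave_norm_def norm_Pair)
    have xy: "?x > 0" "?y > 0" by (auto intro: add_pos_nonneg)
    have "?x * ?y \<le> (2 * ?r) * (2 * ?r)"
    proof -
      have "(1 + p) * (1 + q) \<le> (2 * (p + q)) * (2 * (p + q))" if "p + q \<ge> 1" "p \<ge> 0" "q \<ge> 0" for p q :: real
        using that by (intro mult_mono) auto
      with r show ?thesis by simp
    qed
    then have "((2 * ?r)\<^sup>2) powr (- 3 / 4) \<le> (?x * ?y) powr (- 3 / 4)"
      using xy by (intro powr_mono2') (auto simp: power2_eq_square)
    moreover have "((2 * ?r)\<^sup>2) powr (- 3 / 4) = (2 * ?r) powr (- 3 / 2)"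
      using r by (simp add: powr_powr flip: powr_numeral)
    ultimately have le: "(2 * ?r) powr (- 3 / 2) \<le> ?g (fst k) * ?g (snd k)"
      using xy by (simp add: powr_mult)
    have "mu L k powr (- 3 / 2) = (((2 * pi / L)\<^sup>2 / 2) * (2 * ?r)) powr (- 3 / 2)"
    proof -
      have "a * r = (a / 2) * (2 * r)" for a r :: real by simp
      then show ?thesis unfolding mu_eq by metis
    qed
    also have "\<dots> = ?a * (2 * ?r) powr (- 3 / 2)"
      using r by (subst powr_mult) auto
    also have "\<dots> \<le> ?a * (?g (fst k) * ?g (snd k))"
      by (intro mult_left_mono le) simp
    finally show "mu L k powr (- 3 / 2) \<le> ?a * (?g (fst k) * ?g (snd k))" .
  qed simp
qed

lemma exp_minus_le_powr:
  assumes "x > 0" "0 \<le> a" "a \<le> (1::real)"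
  shows "exp (- x) \<le> x powr (- a)"
proof -
  have "x powr a \<le> exp x"
  proof (cases "x \<le> 1")
    case True
    then have "x powr a \<le> 1" using assms by (intro powr_le1) auto
    also have "\<dots> \<le> exp x" using assms by simp
    finally show ?thesis .
  next
    case False
    then have "x powr a \<le> x powr 1" using assms by (intro powr_mono) auto
    also have "\<dots> \<le> exp x" using assms exp_ge_add_one_self[of x] by (simp del: exp_ge_add_one_self)
    finally show ?thesis .
  qed
  then show ?thesis
    using assms by (simp add: exp_minus powr_minus le_imp_inverse_le)
qed

lemma has_integral_powr_backwards:
  assumes "a > (-1::real)" "t \<ge> 0"
  shows "((\<lambda>s. (t - s) powr a) has_integral (t powr (a + 1) / (a + 1))) {0..t}"
proof -
  have "((\<lambda>x. x powr a) has_integral (t powr (a + 1) / (a + 1))) (cbox 0 t)"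
    using has_integral_powr_from_0[OF assms] by simp
  from has_integral_affinity[OF this, of "-1" t]
  show ?thesis using assms by (simp add: image_affinity_atLeastAtMost_diff image_diff_atLeastAtMost)
qed

text \<open>
  The power \<open>- 7 / 8\<close> of \<open>\<tau>\<close> lies in the window \<open>(- 1, - 3 / 4)\<close>: it is integrable at \<open>0\<close>, and it comes
  with the factor \<open>\<mu>\<^sub>k powr (- 7 / 4)\<close>, which against \<open>\<surd>\<mu>\<^sub>k \<sqdot> \<surd>\<mu>\<^sub>k\<close> leaves \<open>\<mu>\<^sub>k powr (- 3 / 4)\<close>, a square
  summable family.
\<close>

lemma heat_smoothing_bessel:
  assumes L: "L > 0" and K: "finite K" "K \<subseteq> modes" and \<tau>: "\<tau> > 0"
    and N: "(\<Sum>k\<in>K. (N k)\<^sup>2 / mu L k) \<le> b\<^sup>2" and b: "b \<ge> 0"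
  shows "(\<Sum>k\<in>K. sqrt (mu L k) * \<bar>exp (- \<tau> * (mu L k)\<^sup>2) * N k\<bar>)
           \<le> \<tau> powr (- 7 / 8) * (sqrt (\<Sum>\<^sub>\<infinity>k\<in>modes. mu L k powr (- 3 / 2)) * b)"
proof -
  let ?S = "\<Sum>\<^sub>\<infinity>k\<in>modes. mu L k powr (- 3 / 2)"
  have single: "sqrt (mu L k) * \<bar>exp (- \<tau> * (mu L k)\<^sup>2) * N k\<bar>
      \<le> \<tau> powr (- 7 / 8) * (mu L k powr (- 3 / 4) * (\<bar>N k\<bar> / sqrt (mu L k)))" if "k \<in> K" for k
  proof -
    have m: "mu L k > 0" using mu_pos[OF L, of k] that K by auto
    have "exp (- (\<tau> * (mu L k)\<^sup>2)) \<le> (\<tau> * (mu L k)\<^sup>2) powr (- (7 / 8))"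
      using m \<tau> by (intro exp_minus_le_powr) auto
    also have "\<dots> = \<tau> powr (- 7 / 8) * mu L k powr (- 7 / 4)"
      using m \<tau> by (simp add: powr_mult powr_powr flip: powr_numeral)
    finally have e: "exp (- \<tau> * (mu L k)\<^sup>2) \<le> \<tau> powr (- 7 / 8) * mu L k powr (- 7 / 4)" by simp
    have p: "sqrt (mu L k) * mu L k powr (- 7 / 4) = mu L k powr (- 3 / 4) / sqrt (mu L k)"
    proof -
      have half: "sqrt (mu L k) = mu L k powr (1 / 2)"
        using m by (simp add: powr_half_sqrt)
      have exponent: "1 / 2 + - 7 / 4 = - 3 / 4 - (1 / 2 :: real)" by simp
      show ?thesis
        unfolding half powr_add[symmetric] powr_diff[symmetric] exponent ..
    qed
    have "sqrt (mu L k) * \<bar>exp (- \<tau> * (mu L k)\<^sup>2) * N k\<bar>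
        = exp (- \<tau> * (mu L k)\<^sup>2) * (sqrt (mu L k) * \<bar>N k\<bar>)"
      by (simp add: abs_mult)
    also have "\<dots> \<le> (\<tau> powr (- 7 / 8) * mu L k powr (- 7 / 4)) * (sqrt (mu L k) * \<bar>N k\<bar>)"
      using m by (intro mult_right_mono e) auto
    also have "\<dots> = \<tau> powr (- 7 / 8) * ((sqrt (mu L k) * mu L k powr (- 7 / 4)) * \<bar>N k\<bar>)"
      by (simp only: ac_simps)
    finally show ?thesis unfolding p by simp
  qed
  have "(\<Sum>k\<in>K. mu L k powr (- 3 / 4) * (\<bar>N k\<bar> / sqrt (mu L k)))\<^sup>2
      \<le> (\<Sum>k\<in>K. (mu L k powr (- 3 / 4))\<^sup>2) * (\<Sum>k\<in>K. (\<bar>N k\<bar> / sqrt (mu L k))\<^sup>2)"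
    by (rule Cauchy_Schwarz_ineq_sum)
  also have "(\<Sum>k\<in>K. (\<bar>N k\<bar> / sqrt (mu L k))\<^sup>2) = (\<Sum>k\<in>K. (N k)\<^sup>2 / mu L k)"
    by (simp add: power_divide mu_def)
  also have "(\<Sum>k\<in>K. (mu L k powr (- 3 / 4))\<^sup>2) = (\<Sum>k\<in>K. mu L k powr (- 3 / 2))"
    by (simp add: power2_eq_square flip: powr_add)
  also have "\<dots> * (\<Sum>k\<in>K. (N k)\<^sup>2 / mu L k) \<le> ?S * b\<^sup>2"
    by (intro mult_mono N finite_sum_le_infsum summable_on_mu_powr L K sum_nonneg)
       (auto intro: infsum_nonneg simp: mu_def)
  also have "\<dots> = (sqrt ?S * b)\<^sup>2"
    by (simp add: power_mult_distrib infsum_nonneg)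
  finally have cs: "(\<Sum>k\<in>K. mu L k powr (- 3 / 4) * (\<bar>N k\<bar> / sqrt (mu L k))) \<le> sqrt ?S * b"
    by (rule power2_le_imp_le) (intro mult_nonneg_nonneg real_sqrt_ge_zero infsum_nonneg b powr_ge_zero)
  have "(\<Sum>k\<in>K. sqrt (mu L k) * \<bar>exp (- \<tau> * (mu L k)\<^sup>2) * N k\<bar>)
      \<le> \<tau> powr (- 7 / 8) * (\<Sum>k\<in>K. mu L k powr (- 3 / 4) * (\<bar>N k\<bar> / sqrt (mu L k)))"
    unfolding sum_distrib_left by (rule sum_mono[OF single])
  also have "\<dots> \<le> \<tau> powr (- 7 / 8) * (sqrt ?S * b)"
    by (intro mult_left_mono cs) simp
  finally show ?thesis .
qed

text \<open>
  Integration of the smoothing estimate over \<open>s\<close>. Modes whose integrand is not integrable in time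
  contribute \<open>0\<close>, so the sum is restricted to the others, \<open>J\<close>; being finite, it commutes with the
  integral. The bound is uniform in \<open>K\<close> and hence controls the infinite sum.
\<close>

lemma duhamel_gradient_sum_le:
  assumes L: "L > 0" and t: "t \<ge> 0" and K: "finite K" "K \<subseteq> modes" and b: "b \<ge> 0"
    and N: "\<And>s K. \<lbrakk>finite K; K \<subseteq> modes\<rbrakk> \<Longrightarrow> (\<Sum>k\<in>K. (N s k)\<^sup>2 / mu L k) \<le> b\<^sup>2"
  shows "(\<Sum>k\<in>K. sqrt (mu L k) * \<bar>LINT s:{0..t}|lborel. semigroup_A L (t - s) (N s) k\<bar>)
           \<le> 8 * t powr (1 / 8) * (sqrt (\<Sum>\<^sub>\<infinity>k\<in>modes. mu L k powr (- 3 / 2)) * b)"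
proof -
  let ?c = "sqrt (\<Sum>\<^sub>\<infinity>k\<in>modes. mu L k powr (- 3 / 2)) * b"
  define h where "h k s = semigroup_A L (t - s) (N s) k" for k s
  define J where "J = {k \<in> K. set_integrable lborel {0..t} (h k)}"
  have J: "finite J" "J \<subseteq> K" "J \<subseteq> modes" using K by (auto simp: J_def)
  have zero: "(LINT s:{0..t}|lborel. h k s) = 0" if "k \<in> K - J" for k
    using that by (auto simp: J_def set_integrable_def set_lebesgue_integral_def not_integrable_integral_eq)
  have int: "set_integrable lborel {0..t} (\<lambda>s. sqrt (mu L k) * \<bar>h k s\<bar>)" if "k \<in> J" for k
    using that by (intro set_integrable_mult_right impI set_integrable_abs) (auto simp: J_def)
  have "(\<Sum>k\<in>K. sqrt (mu L k) * \<bar>LINT s:{0..t}|lborel. h k s\<bar>)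
      = (\<Sum>k\<in>J. sqrt (mu L k) * \<bar>LINT s:{0..t}|lborel. h k s\<bar>)"
    using zero by (intro sum.mono_neutral_right K(1) J) auto
  also have "\<dots> \<le> (\<Sum>k\<in>J. LINT s:{0..t}|lborel. sqrt (mu L k) * \<bar>h k s\<bar>)"
  proof (rule sum_mono)
    fix k assume "k \<in> J"
    then have "\<bar>LINT s:{0..t}|lborel. h k s\<bar> \<le> (LINT s:{0..t}|lborel. \<bar>h k s\<bar>)"
      using set_integral_norm_bound[of lborel "{0..t}" "h k"] by (simp add: J_def)
    then show "sqrt (mu L k) * \<bar>LINT s:{0..t}|lborel. h k s\<bar> \<le> (LINT s:{0..t}|lborel. sqrt (mu L k) * \<bar>h k s\<bar>)"
      using mult_left_mono[of _ _ "sqrt (mu L k)"] by (simp add: mu_nonneg)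
  qed
  also have "\<dots> = (LINT s:{0..t}|lborel. \<Sum>k\<in>J. sqrt (mu L k) * \<bar>h k s\<bar>)"
    by (rule set_integral_finite_sum(2)[symmetric]) (auto simp: J int)
  also have "\<dots> = integral {0..t} (\<lambda>s. \<Sum>k\<in>J. sqrt (mu L k) * \<bar>h k s\<bar>)"
    by (intro set_borel_integral_eq_integral set_integral_finite_sum J int)
  also have "\<dots> \<le> t powr (1 / 8) / (1 / 8) * ?c"
  proof (rule has_integral_le)
    let ?F = "\<lambda>s. \<Sum>k\<in>J. sqrt (mu L k) * \<bar>h k s\<bar>"
    show "(?F has_integral integral {0..t} ?F) {0..t}"
      by (intro integrable_integral set_borel_integral_eq_integral set_integral_finite_sum J int)
    have "((\<lambda>s. (t - s) powr (- 7 / 8) * ?c) has_integral (t powr (1 / 8) / (1 / 8) * ?c)) {0..t}"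
      using has_integral_mult_left[OF has_integral_powr_backwards[of "- 7 / 8" t], of ?c] t by simp
    \<comment> \<open>At \<open>s = t\<close> the bound \<open>(t - s) powr (- 7 / 8)\<close> is \<open>0\<close> by convention, so it is redefined there.\<close>
    then show "((\<lambda>s. if s = t then ?F t else (t - s) powr (- 7 / 8) * ?c)
        has_integral (t powr (1 / 8) / (1 / 8) * ?c)) {0..t}"
      by (rule has_integral_spike_finite[rotated 2, where S = "{t}"]) auto
    show "?F s \<le> (if s = t then ?F t else (t - s) powr (- 7 / 8) * ?c)" if "s \<in> {0..t}" for s
      using that heat_smoothing_bessel[OF L J(1,3) _ N[OF J(1,3), of s] b, of "t - s"]
      by (auto simp: h_def semigroup_A_def)
  qed
  finally show ?thesis by (simp add: h_def)
qed

section \<open>Termwise differentiation and the gradient bound\<close>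

text \<open>
  By the Weierstrass test the partial sums of the gradients, along an enumeration of \<open>A\<close>, converge
  uniformly on the whole space, which is what termwise differentiation requires.
\<close>

lemma GDERIV_infsum:
  fixes f :: "'i \<Rightarrow> 'a::euclidean_space \<Rightarrow> real"
  assumes A: "countable A" "infinite A"
    and deriv: "\<And>k x. k \<in> A \<Longrightarrow> GDERIV (f k) x :> G k x"
    and bound: "\<And>k x. k \<in> A \<Longrightarrow> norm (G k x) \<le> b k"
    and b: "b summable_on A"
    and f: "\<And>x. (\<lambda>k. f k x) summable_on A"
  shows "GDERIV (\<lambda>x. \<Sum>\<^sub>\<infinity>k\<in>A. f k x) x :> (\<Sum>\<^sub>\<infinity>k\<in>A. G k x)"
    and "norm (\<Sum>\<^sub>\<infinity>k\<in>A. G k x) \<le> infsum b A"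
proof -
  have absG: "(\<lambda>k. norm (G k x)) summable_on A" for x
    by (rule summable_on_comparison_test[OF b]) (auto intro: bound)
  have "norm (\<Sum>\<^sub>\<infinity>k\<in>A. G k x) \<le> (\<Sum>\<^sub>\<infinity>k\<in>A. norm (G k x))"
    by (rule norm_infsum_bound[OF absG])
  also have "\<dots> \<le> infsum b A"
    by (intro infsum_mono absG b bound)
  finally show "norm (\<Sum>\<^sub>\<infinity>k\<in>A. G k x) \<le> infsum b A" .
  define e where "e = from_nat_into A"
  have e: "bij_betw e UNIV A"
    unfolding e_def by (rule bij_betw_from_nat_into[OF A])
  have eA: "e n \<in> A" for n using e by (auto simp: bij_betw_def)
  have sumsf: "(\<lambda>n. f (e n) x) sums (\<Sum>\<^sub>\<infinity>k\<in>A. f k x)" for x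
    by (intro has_sum_imp_sums) (simp add: has_sum_reindex_bij_betw[OF e, of "\<lambda>k. f k x"] f)
  have sumsG: "(\<lambda>n. G (e n) x) sums (\<Sum>\<^sub>\<infinity>k\<in>A. G k x)" for x
    by (intro has_sum_imp_sums)
       (simp add: has_sum_reindex_bij_betw[OF e, of "\<lambda>k. G k x"] abs_summable_summable[OF absG])
  have sb: "summable (\<lambda>n. b (e n))"
    using b by (intro summable_on_imp_summable) (simp add: summable_on_reindex_bij_betw[OF e])
  have ul: "uniform_limit UNIV (\<lambda>n x. \<Sum>i<n. G (e i) x) (\<lambda>x. \<Sum>i. G (e i) x) sequentially"
    by (rule Weierstrass_m_test[OF _ sb]) (auto intro: bound eA)
  have "\<exists>g. \<forall>x\<in>UNIV. (\<lambda>n. f (e n) x) sums (g x) \<and>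
      (g has_derivative (\<lambda>h. h \<bullet> (\<Sum>\<^sub>\<infinity>k\<in>A. G k x))) (at x within UNIV)"
  proof (rule has_derivative_series[where f = "\<lambda>n. f (e n)" and f' = "\<lambda>n x h. h \<bullet> G (e n) x"])
    show "(f (e n) has_derivative (\<lambda>h. h \<bullet> G (e n) x)) (at x within UNIV)" for n x
      using deriv[OF eA] by (simp add: gderiv_def)
    fix r :: real assume "r > 0"
    from uniform_limitD[OF ul this]
    show "\<forall>\<^sub>F n in sequentially. \<forall>x\<in>UNIV. \<forall>h.
        norm ((\<Sum>i<n. h \<bullet> G (e i) x) - h \<bullet> (\<Sum>\<^sub>\<infinity>k\<in>A. G k x)) \<le> r * norm h"
    proof eventually_elim
      case (elim n)
      show ?case
      proof (intro ballI allI)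
        fix x h
        have "norm ((\<Sum>i<n. h \<bullet> G (e i) x) - h \<bullet> (\<Sum>\<^sub>\<infinity>k\<in>A. G k x))
            = \<bar>h \<bullet> ((\<Sum>i<n. G (e i) x) - (\<Sum>\<^sub>\<infinity>k\<in>A. G k x))\<bar>"
          by (simp add: inner_diff_right inner_sum_right)
        also have "\<dots> \<le> norm h * norm ((\<Sum>i<n. G (e i) x) - (\<Sum>\<^sub>\<infinity>k\<in>A. G k x))"
          by (rule Cauchy_Schwarz_ineq2)
        also have "\<dots> \<le> norm h * r"
          using elim sums_unique[OF sumsG, of x]
          by (intro mult_left_mono) (auto simp: dist_norm intro: less_imp_le)
        finally show "norm ((\<Sum>i<n. h \<bullet> G (e i) x) - h \<bullet> (\<Sum>\<^sub>\<infinity>k\<in>A. G k x)) \<le> r * norm h"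
          by (simp add: mult.commute)
      qed
    qed
  qed (use sumsf in auto)
  then obtain g where g: "\<And>x. (\<lambda>n. f (e n) x) sums (g x)"
      "\<And>x. (g has_derivative (\<lambda>h. h \<bullet> (\<Sum>\<^sub>\<infinity>k\<in>A. G k x))) (at x)"
    by auto
  have "g = (\<lambda>x. \<Sum>\<^sub>\<infinity>k\<in>A. f k x)"
    using sums_unique2[OF g(1) sumsf] by auto
  with g(2) show "GDERIV (\<lambda>x. \<Sum>\<^sub>\<infinity>k\<in>A. f k x) x :> (\<Sum>\<^sub>\<infinity>k\<in>A. G k x)"
    by (simp add: gderiv_def)
qed

text \<open>
  As \<open>|\<nabla>e\<^sub>k| \<le> (2 / L) \<surd>\<mu>\<^sub>k\<close>, the hypothesis makes the differentiated series absolutely convergent.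
  The series itself converges too, because \<open>\<mu>\<^sub>k\<close> is bounded away from \<open>0\<close> on the nonzero modes.
\<close>

lemma gradient_bounded_series:
  assumes L: "L > 0" and fin: "\<And>K. \<lbrakk>finite K; K \<subseteq> modes\<rbrakk> \<Longrightarrow> (\<Sum>k\<in>K. sqrt (mu L k) * \<bar>v k\<bar>) \<le> b"
  shows "gradient_bounded_at L (2 / L * b) v x"
proof -
  let ?m = "\<lambda>k. sqrt (mu L k) * \<bar>v k\<bar>"
  have m: "?m summable_on modes"
    by (rule nonneg_bdd_above_summable_on) (auto intro!: bdd_aboveI[where M = b] fin simp: mu_nonneg)
  have vb: "(\<lambda>k. v k * basis L k x) summable_on modes" for x
  proof (rule abs_summable_summable, rule summable_on_comparison_test)
    show "(\<lambda>k. 2 / L * (L / (2 * pi)) * ?m k) summable_on modes"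
      by (rule summable_on_cmult_right[OF m])
    fix k assume "k \<in> modes"
    then have "2 * pi / L \<le> sqrt (mu L k)"
      using wave_norm_ge_1[of k] L by (simp add: mu_def divide_right_mono)
    then have 1: "1 \<le> L / (2 * pi) * sqrt (mu L k)"
      using L by (simp add: field_simps)
    have "norm (v k * basis L k x) \<le> (1 * \<bar>v k\<bar>) * (2 / L)"
      using mult_left_mono[OF abs_basis_le[OF L, of k x], of "\<bar>v k\<bar>"] by (simp add: abs_mult)
    also have "\<dots> \<le> ((L / (2 * pi) * sqrt (mu L k)) * \<bar>v k\<bar>) * (2 / L)"
      by (intro mult_right_mono 1) (use L in auto)
    finally show "norm (v k * basis L k x) \<le> 2 / L * (L / (2 * pi)) * ?m k"
      by (simp only: ac_simps)
  qed simp
  have inf: "infinite modes"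
    unfolding modes_def by (intro Diff_infinite_finite) (auto simp: finite_prod)
  have D: "GDERIV (\<lambda>x. v k * basis L k x) x :> v k *\<^sub>R basis_grad L k x" for k x
    using GDERIV_mult[OF GDERIV_const GDERIV_basis[OF L, of k x], of "v k"] by simp
  have n: "norm (v k *\<^sub>R basis_grad L k x) \<le> 2 / L * ?m k" for k x
    using mult_left_mono[OF norm_basis_grad_le[OF L, of k x], of "\<bar>v k\<bar>"]
    by (simp add: algebra_simps)
  have m2: "(\<lambda>k. 2 / L * ?m k) summable_on modes"
    by (rule summable_on_cmult_right[OF m])
  note G = GDERIV_infsum[OF countableI_type inf, of "\<lambda>k x. v k * basis L k x", OF D n m2 vb, of x]
  have "infsum (\<lambda>k. 2 / L * ?m k) modes = 2 / L * infsum ?m modes"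
    using m by (rule infsum_cmult_right)
  also have "\<dots> \<le> 2 / L * b"
    using L by (intro mult_left_mono infsum_le_finite_sums[OF m] fin) auto
  finally have "norm (\<Sum>\<^sub>\<infinity>k\<in>modes. v k *\<^sub>R basis_grad L k x) \<le> 2 / L * b"
    using G(2) by linarith
  with G(1) vb[of x] show ?thesis
    unfolding gradient_bounded_at_def series_value_def[abs_def] by blast
qed

lemma gradient_bounded_at_cong:
  assumes "\<And>k. k \<in> modes \<Longrightarrow> v k = w k"
  shows "gradient_bounded_at L C v x \<longleftrightarrow> gradient_bounded_at L C w x"
proof -
  have "series_value L v = series_value L w"
    unfolding series_value_def[abs_def] using assms by (auto intro!: ext infsum_cong)
  moreover have "(\<lambda>k. v k * basis L k x) summable_on modes \<longleftrightarrow> (\<lambda>k. w k * basis L k x) summable_on modes"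
    using assms by (intro summable_on_cong) auto
  ultimately show ?thesis by (simp add: gradient_bounded_at_def)
qed

lemma gradient_bounded_at_mono:
  "gradient_bounded_at L C v x \<Longrightarrow> C \<le> C' \<Longrightarrow> gradient_bounded_at L C' v x"
  unfolding gradient_bounded_at_def by (meson order_trans)

text \<open>
  The factor \<open>2 / L\<close> from the gradients of the basis cancels against the \<open>L / 2\<close> of the Bessel bound, and
  \<open>8 T powr (1 / 8)\<close> is the integral of \<open>\<tau> powr (- 7 / 8)\<close> over \<open>[0, T]\<close>.
\<close>

definition gradient_const :: "real \<Rightarrow> real \<Rightarrow> real" where
  "gradient_const L T = 8 * T powr (1 / 8) * sqrt (\<Sum>\<^sub>\<infinity>k\<in>modes. mu L k powr (- 3 / 2))"

lemma mild_path_remainder_gradient_bounded: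
  assumes L: "L > 0" and t: "t \<in> {0..T}"
    and path: "mild_path L T u0 (\<lambda>t. Z t w) (\<lambda>t. u t w)"
  shows "gradient_bounded_at L (gradient_const L T) (remainder_v L u0 Z u t w) x"
proof -
  let ?v = "\<lambda>k. LINT s:{0..t}|lborel. semigroup_A L (t - s) (nonlinearity L (u s w)) k"
  let ?c = "sqrt (\<Sum>\<^sub>\<infinity>k\<in>modes. mu L k powr (- 3 / 2))"
  have bessel: "(\<Sum>k\<in>K. (nonlinearity L (u s w) k)\<^sup>2 / mu L k) \<le> (1 / 2 * L)\<^sup>2"
    if "finite K" "K \<subseteq> modes" for s K
    unfolding nonlinearity_def by (intro bessel_basis_gradients L that norm_flux_le)
  have "(\<Sum>k\<in>K. sqrt (mu L k) * \<bar>?v k\<bar>) \<le> 8 * t powr (1 / 8) * (?c * (1 / 2 * L))"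
    if "finite K" "K \<subseteq> modes" for K
    using t L by (intro duhamel_gradient_sum_le that bessel) auto
  then have "gradient_bounded_at L (2 / L * (8 * t powr (1 / 8) * (?c * (1 / 2 * L)))) ?v x"
    by (rule gradient_bounded_series[OF L])
  moreover have "2 / L * (8 * t powr (1 / 8) * (?c * (1 / 2 * L))) \<le> gradient_const L T"
  proof -
    have "t powr (1 / 8) \<le> T powr (1 / 8)"
      using t by (intro powr_mono2) auto
    then have "8 * t powr (1 / 8) * ?c \<le> 8 * T powr (1 / 8) * ?c"
      by (intro mult_right_mono) (auto intro: infsum_nonneg)
    then show ?thesis using L by (simp add: gradient_const_def)
  qed
  ultimately have "gradient_bounded_at L (gradient_const L T) ?v x"
    by (rule gradient_bounded_at_mono)
  moreover have "remainder_v L u0 Z u t w k = ?v k" if "k \<in> modes" for k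
    using path t that by (simp add: remainder_v_def mild_path_def)
  ultimately show ?thesis
    by (subst gradient_bounded_at_cong[where w = ?v])
qed

theorem theorem7:
  fixes L T :: real
  assumes "L > 0" and "T > 0"
  shows "\<exists>C>0. \<forall>(M :: 'a measure) \<beta> z \<alpha> u0 (u :: real \<Rightarrow> real \<Rightarrow> 'a \<Rightarrow> coeffs).
    prob_space M \<and> independent_wiener_family M modes \<beta> \<and> stochastic_convolution M L \<beta> z \<and>
    regularization \<alpha> \<and> in_H L 1 u0 \<and>
    (\<forall>\<epsilon>>0. mild_solution M L T u0 (noise_Z \<alpha> z \<epsilon>) (u \<epsilon>))
    \<longrightarrow>
    (\<forall>\<epsilon>>0. AE w in M. \<forall>t\<in>{0..T}. \<forall>x\<in>torus L.
        gradient_bounded_at L C (remainder_v L u0 (noise_Z \<alpha> z \<epsilon>) (u \<epsilon>) t w) x) \<and>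
    ((AE w in M. \<forall>\<epsilon>>0. mild_path L T u0 (\<lambda>t. noise_Z \<alpha> z \<epsilon> t w) (\<lambda>t. u \<epsilon> t w)) \<longrightarrow>
     (AE w in M. \<forall>\<epsilon>>0. \<forall>t\<in>{0..T}. \<forall>x\<in>torus L.
        gradient_bounded_at L C (remainder_v L u0 (noise_Z \<alpha> z \<epsilon>) (u \<epsilon>) t w) x))"
  \<comment> \<open>Adding \<open>1\<close> makes the constant visibly positive.\<close>
proof (intro exI[of _ "gradient_const L T + 1"] conjI allI impI)
  have "gradient_const L T \<ge> 0"
    unfolding gradient_const_def by (intro mult_nonneg_nonneg real_sqrt_ge_zero infsum_nonneg) auto
  then show "gradient_const L T + 1 > 0" by simp
next
  fix M :: "'a measure" and \<beta> z \<alpha> u0 and u :: "real \<Rightarrow> real \<Rightarrow> 'a \<Rightarrow> coeffs"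
  assume *: "prob_space M \<and> independent_wiener_family M modes \<beta> \<and> stochastic_convolution M L \<beta> z \<and>
    regularization \<alpha> \<and> in_H L 1 u0 \<and>
    (\<forall>\<epsilon>>0. mild_solution M L T u0 (noise_Z \<alpha> z \<epsilon>) (u \<epsilon>))"
  have bound: "gradient_bounded_at L (gradient_const L T + 1)
      (remainder_v L u0 (noise_Z \<alpha> z \<epsilon>) (u \<epsilon>) t w) x"
    if "mild_path L T u0 (\<lambda>t. noise_Z \<alpha> z \<epsilon> t w) (\<lambda>t. u \<epsilon> t w)" "t \<in> {0..T}" for \<epsilon> t w x
    using mild_path_remainder_gradient_bounded[where Z = "noise_Z \<alpha> z \<epsilon>" and u = "u \<epsilon>", OF assms(1) that(2,1)]
    by (rule gradient_bounded_at_mono) simp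
  show "AE w in M. \<forall>t\<in>{0..T}. \<forall>x\<in>torus L.
        gradient_bounded_at L (gradient_const L T + 1) (remainder_v L u0 (noise_Z \<alpha> z \<epsilon>) (u \<epsilon>) t w) x"
    if "\<epsilon> > 0" for \<epsilon>
  proof -
    have "AE w in M. mild_path L T u0 (\<lambda>t. noise_Z \<alpha> z \<epsilon> t w) (\<lambda>t. u \<epsilon> t w)"
      using * that by (simp add: mild_solution_def)
    then show ?thesis
      by eventually_elim (use bound in blast)
  qed
  show "AE w in M. \<forall>\<epsilon>>0. \<forall>t\<in>{0..T}. \<forall>x\<in>torus L.
        gradient_bounded_at L (gradient_const L T + 1) (remainder_v L u0 (noise_Z \<alpha> z \<epsilon>) (u \<epsilon>) t w) x"
    if "AE w in M. \<forall>\<epsilon>>0. mild_path L T u0 (\<lambda>t. noise_Z \<alpha> z \<epsilon> t w) (\<lambda>t. u \<epsilon> t w)"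
    using that by eventually_elim (use bound in blast)
qed

end
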